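(* Let $k\ge2$ be an integer, let $a\in\mathbb{F}_q^*$, and let $\mathcal{F}_k$ be the set of monic polynomials in $\mathbb{F}_q[x]$ which are $k$-th power free. Then, for any $0<B<1$, $$\frac1{q^n}\sum_{\substack{f\in\mathcal{M}_n\\ f,\,f+a\in\mathcal{F}_k}}1=\prod_P\Big(1-\frac{2}{q^{k\deg P}}\Big)+O\Big(\frac1{n^B}\Big),$$ where the product runs over all monic irreducible polynomials $P$.
   Context: $\mathbb{F}_q$ is a fixed finite field of odd cardinality $q$; $\mathcal{M}_n$ is the set of monic polynomials of degree $n$ in $\mathbb{F}_q[x]$. A polynomial is $k$-th power free if it is not divisible by $P^k$ for any monic irreducible $P$. The asymptotic is as $n\to\infty$ with $q,k,a,B$ fixed; the implied constant may depend on them. *)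

theory Defs
  imports
    "HOL-Analysis.Infinite_Sum"
    "HOL-Computational_Algebra.Polynomial_Factorial"
    "HOL-Library.Landau_Symbols"
    "HOL-Library.Cardinality"
begin

definition monic_polys :: "nat \<Rightarrow> 'a::field poly set" where
  "monic_polys n = {f. lead_coeff f = 1 \<and> degree f = n}"

definition monic_irreducibles :: "'a::field poly set" where
  "monic_irreducibles = {P. lead_coeff P = 1 \<and> irreducible P}"

definition kth_power_free :: "nat \<Rightarrow> 'a::field poly \<Rightarrow> bool" where
  "kth_power_free k f \<longleftrightarrow> (\<forall>P\<in>monic_irreducibles. \<not> P ^ k dvd f)"

definition monic_kth_power_free :: "nat \<Rightarrow> 'a::field poly set" where
  "monic_kth_power_free k = {f. lead_coeff f = 1 \<and> kth_power_free k f}"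

(* Unordered infinite products, the multiplicative counterpart of has_sum and infsum:
   limits of the net of finite partial products.  infinite_product f A is only
   meaningful when the product converges, i.e. has_infinite_product f A p for some p. *)

definition has_infinite_product :: "('i \<Rightarrow> real) \<Rightarrow> 'i set \<Rightarrow> real \<Rightarrow> bool" where
  "has_infinite_product f A p \<longleftrightarrow> (prod f \<longlongrightarrow> p) (finite_subsets_at_top A)"

definition infinite_product :: "('i \<Rightarrow> real) \<Rightarrow> 'i set \<Rightarrow> real" where
  "infinite_product f A = Lim (finite_subsets_at_top A) (prod f)"

end

theory Submission
  imports Defs "HOL-Analysis.Infinite_Products" "HOL-Real_Asymp.Real_Asymp"
begin

text \<open>For the irreducibles \<open>P\<close> of degree at most \<open>y\<close>, the conditions
  \<open>f \<noteq> 0, -a\<close> modulo \<open>P ^ k\<close> are independent by the Chinese remainder theorem, and as soon as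
  the product of these moduli has degree at most \<open>n\<close> the count is exactly \<open>q ^ n\<close> times the
  partial product. The irreducibles of larger degree contribute at most \<open>2 / q ^ y\<close>, by the
  union bound for the count and by Weierstrass' inequality for the product. The choice
  \<open>y = \<lfloor>B log\<^sub>q n\<rfloor>\<close> is admissible because \<open>k y q ^ (y + 1)\<close>, a bound for the degree of the
  modulus, is then \<open>O(n powr B * ln n)\<close>, and it gives \<open>q ^ -y = O(n powr -B)\<close>.\<close>

section \<open>Coprimality of polynomials over a field\<close>

text \<open>The Euclidean algorithm: \<open>(a, b)\<close> is replaced by the coprime pair
  \<open>(b, a mod b)\<close>, and the coefficients are carried back through
  \<open>a mod b = a - (a div b) * b\<close>.\<close>

lemma coprime_bezout:
  fixes a b :: "'a::unique_euclidean_ring"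
  assumes "coprime a b"
  shows "\<exists>u v. u * a + v * b = 1"
  using assms
proof (induction "euclidean_size b" arbitrary: a b rule: less_induct)
  case less
  show ?case
  proof (cases "b = 0")
    case True
    with less.prems have "a dvd 1" by simp
    then show ?thesis using True by (metis dvdE mult.commute add.right_neutral mult_zero_right)
  next
    case False
    have "coprime b (a mod b)"
      using less.prems False by (simp add: coprime_commute)
    with less.hyps False obtain u v where "u * b + v * (a mod b) = 1"
      using mod_size_less by blast
    then have "v * a + (u - v * (a div b)) * b = 1"
      by (simp add: minus_div_mult_eq_mod [symmetric] algebra_simps)
    then show ?thesis by blast
  qed
qed

text \<open>Multiplying \<open>u * a + v * c = 1\<close> by \<open>b\<close> writes \<open>b\<close>
  as a combination of \<open>a * b\<close> and \<open>c\<close>, so a common divisor of these two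
  also divides \<open>b\<close>.\<close>

lemma coprime_mult_leftI:
  fixes a b c :: "'a::unique_euclidean_ring"
  assumes "coprime a c" "coprime b c"
  shows "coprime (a * b) c"
proof -
  obtain u v where 1: "u * a + v * c = 1" using coprime_bezout[OF assms(1)] by blast
  show ?thesis
  proof (rule coprimeI)
    fix d assume d: "d dvd a * b" "d dvd c"
    have "b = u * (a * b) + v * b * c" using 1 by (metis (no_types) distrib_right mult.assoc mult.commute mult_1)
    also have "d dvd \<dots>" using d by auto
    finally show "d dvd 1" using d(2) assms(2) by (meson coprime_common_divisor)
  qed
qed

lemma coprime_power_leftI:
  fixes a c :: "'a::unique_euclidean_ring"
  shows "coprime a c \<Longrightarrow> coprime (a ^ n) c"
  by (induction n) (auto intro: coprime_mult_leftI)

text \<open>A common divisor that is not a unit is associated to both \<open>P\<close> and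
  \<open>Q\<close>. These then differ by a constant factor, which comparison of leading coefficients
  shows to be 1.\<close>

lemma monic_irreducibles_coprime:
  fixes P Q :: "'a::field poly"
  assumes P: "P \<in> monic_irreducibles" and Q: "Q \<in> monic_irreducibles" and "P \<noteq> Q"
  shows "coprime P Q"
proof (rule coprimeI)
  fix d assume d: "d dvd P" "d dvd Q"
  show "d dvd 1"
  proof (rule ccontr)
    assume "\<not> d dvd 1"
    with d P Q have "P dvd d" "Q dvd d"
      by (auto simp: monic_irreducibles_def dest: irreducibleD')
    with d have "P dvd Q" "Q dvd P" by (auto intro: dvd_trans)
    have nz: "P \<noteq> 0" "Q \<noteq> 0" using P Q by (auto simp: monic_irreducibles_def)
    obtain c where c: "Q = P * c" using \<open>P dvd Q\<close> by (rule dvdE)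
    have "degree Q \<le> degree P" using \<open>Q dvd P\<close> nz(1) by (rule dvd_imp_degree_le)
    with c nz have "degree c = 0" by (auto simp: degree_mult_eq)
    then obtain b where b: "c = [:b:]" by (rule degree_eq_zeroE)
    have "lead_coeff Q = lead_coeff P * lead_coeff c" unfolding c by (rule lead_coeff_mult)
    with P Q b have "b = 1" by (simp add: monic_irreducibles_def)
    with b c \<open>P \<noteq> Q\<close> show False by simp
  qed
qed

lemma degree_monic_irreducible_pos:
  fixes P :: "'a::field poly"
  shows "P \<in> monic_irreducibles \<Longrightarrow> degree P > 0"
  by (rule ccontr) (auto simp: monic_irreducibles_def irreducible_def is_unit_iff_degree)

text \<open>With \<open>u * a + v * b = 1\<close>, the element \<open>s * u * a + r * v * b\<close>
  is congruent to \<open>r\<close> modulo \<open>a\<close> and to \<open>s\<close> modulo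
  \<open>b\<close>. Fusing two congruences into one lets the sieve absorb a modulus into
  \<open>D\<close>.\<close>

lemma chinese_remainder_coprime:
  fixes a b :: "'a::unique_euclidean_ring"
  assumes "coprime a b"
  obtains t where "\<And>f. a dvd f - r \<and> b dvd f - s \<longleftrightarrow> a * b dvd f - t"
proof -
  obtain u v where uv: "u * a + v * b = 1" using coprime_bezout[OF assms] by blast
  define t where "t = s * u * a + r * v * b"
  have "t - r = t - r * (u * a + v * b)" "t - s = t - s * (u * a + v * b)" using uv by simp_all
  then have "t - r = a * (u * (s - r))" "t - s = b * (v * (r - s))"
    by (simp_all add: t_def algebra_simps)
  then have *: "a dvd t - r" "b dvd t - s" by (auto intro: dvdI)
  have "a dvd f - r \<and> b dvd f - s \<longleftrightarrow> a * b dvd f - t" for f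
  proof -
    have "a dvd f - r \<longleftrightarrow> a dvd f - t"
      using dvd_add_left_iff[OF *(1), of "f - t"] by simp
    moreover have "b dvd f - s \<longleftrightarrow> b dvd f - t"
      using dvd_add_left_iff[OF *(2), of "f - t"] by simp
    moreover have "a * b dvd f - t" if "a dvd f - t" "b dvd f - t"
    proof -
      \<comment> \<open>In each summand one factor \<open>a\<close> or \<open>b\<close> is explicit
        and the other divides \<open>f - t\<close>.\<close>
      have "f - t = (f - t) * (u * a + v * b)" using uv by simp
      also have "\<dots> = u * (a * (f - t)) + v * ((f - t) * b)" by (simp add: algebra_simps)
      also have "a * b dvd \<dots>"
        using that by (intro dvd_add dvd_mult mult_dvd_mono) auto
      finally show ?thesis .
    qed
    ultimately show ?thesis by (meson dvd_mult_left dvd_mult_right)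
  qed
  then show ?thesis by (rule that)
qed

section \<open>Counting monic polynomials\<close>

lemma monic_polys_0: "monic_polys 0 = {1 :: 'a::field poly}"
  by (auto simp: monic_polys_def one_pCons elim!: degree_eq_zeroE)

lemma monic_polys_Suc:
  "monic_polys (Suc n) = (\<lambda>(c, f). pCons c f) ` (UNIV \<times> (monic_polys n :: 'a::field poly set))"
proof (intro set_eqI iffI)
  fix f :: "'a poly" assume f: "f \<in> monic_polys (Suc n)"
  obtain c g where "f = pCons c g" by (cases f)
  with f show "f \<in> (\<lambda>(c, f). pCons c f) ` (UNIV \<times> monic_polys n)"
    by (auto simp: monic_polys_def split: if_splits)
qed (auto simp: monic_polys_def split: if_splits)

lemma finite_monic_polys [simp]: "finite (monic_polys n :: 'a::{finite,field} poly set)"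
  by (induction n) (auto simp: monic_polys_0 monic_polys_Suc)

lemma card_monic_polys: "card (monic_polys n :: 'a::{finite,field} poly set) = CARD('a) ^ n"
proof (induction n)
  case (Suc n)
  have "inj_on (\<lambda>(c, f). pCons c f) (UNIV \<times> (monic_polys n :: 'a poly set))"
    by (auto simp: inj_on_def)
  then show ?case using Suc by (simp add: monic_polys_Suc card_image)
qed (simp add: monic_polys_0)

lemma monic_polys_diff:
  fixes f r :: "'a::field poly"
  assumes "degree r < n" "f \<in> monic_polys n"
  shows "f - r \<in> monic_polys n"
proof -
  have "degree (f + (- r)) = degree f"
    using assms by (intro degree_add_eq_left) (auto simp: monic_polys_def)
  with assms show ?thesis by (auto simp: monic_polys_def coeff_eq_0)
qed

text \<open>Division with remainder: \<open>g\<close> \<mapsto> \<open>g * D + r mod D\<close> is a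
  bijection from the monic polynomials of degree \<open>n - degree D\<close> onto the residue
  class.\<close>

lemma card_monic_polys_residue:
  fixes D r :: "'a::{finite,field} poly"
  assumes "lead_coeff D = 1" and "degree D \<le> n"
  shows "real (card {f \<in> monic_polys n. D dvd f - r}) = real CARD('a) ^ n / real CARD('a) ^ degree D"
proof -
  have "D \<noteq> 0" using assms(1) by auto
  have deg: "r mod D = 0 \<or> degree (r mod D) < degree D" using \<open>D \<noteq> 0\<close> by (rule degree_mod_less)
  \<comment> \<open>The remainder has smaller degree than \<open>D\<close>, so adding it leaves the
    leading term of \<open>h\<close> intact.\<close>
  have shift: "lead_coeff (h + r mod D) = lead_coeff h \<and> degree (h + r mod D) = degree h"
    if "degree D \<le> degree h" for h
  proof (cases "r mod D = 0")
    case False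
    with deg that have "degree (r mod D) < degree h" by simp
    then show ?thesis by (simp add: degree_add_eq_left coeff_eq_0)
  qed simp
  have "{f \<in> monic_polys n. D dvd f - r} = (\<lambda>g. g * D + r mod D) ` monic_polys (n - degree D)"
  proof (intro set_eqI iffI)
    fix f assume "f \<in> {f \<in> monic_polys n. D dvd f - r}"
    then have f: "lead_coeff f = 1" "degree f = n" "D dvd f - r" by (auto simp: monic_polys_def)
    then have fr: "f mod D = r mod D" by (simp add: mod_eq_dvd_iff)
    define g where "g = f div D"
    have fg: "f = g * D + r mod D" unfolding g_def fr [symmetric] by simp
    have "g \<noteq> 0"
    proof
      assume "g = 0"
      with fg have "f = r mod D" by simp
      with f deg assms(2) show False by auto
    qed
    then have "lead_coeff f = lead_coeff (g * D)" and "degree f = degree g + degree D"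
      using shift[of "g * D"] fg \<open>D \<noteq> 0\<close> by (auto simp: degree_mult_eq)
    then have "lead_coeff g = 1" "degree g = n - degree D"
      using f(1,2) assms(1) unfolding lead_coeff_mult by simp_all
    then have "g \<in> monic_polys (n - degree D)" by (simp add: monic_polys_def)
    with fg show "f \<in> (\<lambda>g. g * D + r mod D) ` monic_polys (n - degree D)" by blast
  next
    fix f assume "f \<in> (\<lambda>g. g * D + r mod D) ` monic_polys (n - degree D)"
    then obtain g where g: "g \<in> monic_polys (n - degree D)" "f = g * D + r mod D" by blast
    then have "g \<noteq> 0" by (auto simp: monic_polys_def)
    then have gD: "degree (g * D) = n" "lead_coeff (g * D) = 1"
      using g(1) \<open>D \<noteq> 0\<close> assms unfolding lead_coeff_mult by (auto simp: monic_polys_def degree_mult_eq)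
    have "degree D \<le> degree (g * D)" using gD(1) assms(2) by simp
    from shift[OF this] have "lead_coeff f = lead_coeff (g * D)" "degree f = degree (g * D)"
      unfolding g(2) by blast+
    then have "f \<in> monic_polys n" using gD by (simp add: monic_polys_def)
    moreover have "f mod D = r mod D" using g by simp
    ultimately show "f \<in> {f \<in> monic_polys n. D dvd f - r}" by (simp add: mod_eq_dvd_iff)
  qed
  moreover have "inj_on (\<lambda>g. g * D + r mod D) (monic_polys (n - degree D))"
    using \<open>D \<noteq> 0\<close> by (auto simp: inj_on_def)
  ultimately have "card {f \<in> monic_polys n. D dvd f - r} = CARD('a) ^ (n - degree D)"
    by (simp add: card_image card_monic_polys)
  then show ?thesis using assms(2) power_diff[of "real CARD('a)" "degree D" n] by simp
qed

text \<open>For \<open>degree D > n\<close> the class is empty, since \<open>f - r\<close> is monic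
  of degree \<open>n\<close> and too small to be a multiple of \<open>D\<close>. The union bound
  needs this case because \<open>P ^ k\<close> may have degree above \<open>n\<close>.\<close>

lemma card_monic_polys_residue_le:
  fixes D r :: "'a::{finite,field} poly"
  assumes "lead_coeff D = 1" and "degree r < n"
  shows "real (card {f \<in> monic_polys n. D dvd f - r}) \<le> real CARD('a) ^ n / real CARD('a) ^ degree D"
proof (cases "degree D \<le> n")
  case False
  have "\<not> D dvd f - r" if "f \<in> monic_polys n" for f
    using monic_polys_diff[OF assms(2) that] False
    by (auto simp: monic_polys_def dest: dvd_imp_degree_le)
  then have "{f \<in> monic_polys n. D dvd f - r} = {}" by blast
  then show ?thesis by (simp only: card.empty) simp
qed (use card_monic_polys_residue[OF assms(1)] in simp)

section \<open>The exact count for finitely many moduli\<close>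

text \<open>The induction removes one modulus \<open>m i\<close> at a time; the residue condition modulo \<open>D\<close>
  absorbs the classes \<open>0\<close> and \<open>- c\<close> modulo \<open>m i\<close>, which are disjoint because \<open>m i\<close> does not
  divide \<open>c\<close>.\<close>

lemma card_sieve:
  fixes D r c :: "'a::{finite,field} poly" and m :: "'i \<Rightarrow> 'a poly"
  assumes "finite S"
    and "lead_coeff D = 1" and "\<And>i. i \<in> S \<Longrightarrow> lead_coeff (m i) = 1"
    and "\<And>i. i \<in> S \<Longrightarrow> coprime D (m i)"
    and "\<And>i j. i \<in> S \<Longrightarrow> j \<in> S \<Longrightarrow> i \<noteq> j \<Longrightarrow> coprime (m i) (m j)"
    and "\<And>i. i \<in> S \<Longrightarrow> \<not> m i dvd c"
    and "degree D + (\<Sum>i\<in>S. degree (m i)) \<le> n"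
  shows "real (card {f \<in> monic_polys n. D dvd f - r \<and> (\<forall>i\<in>S. \<not> m i dvd f \<and> \<not> m i dvd f + c)})
    = real CARD('a) ^ n / real CARD('a) ^ degree D * (\<Prod>i\<in>S. 1 - 2 / real CARD('a) ^ degree (m i))"
  using assms
proof (induction S arbitrary: D r rule: finite_induct)
  case empty
  then show ?case by (simp add: card_monic_polys_residue)
next
  case (insert i S)
  define N where "N D r = {f \<in> monic_polys n. D dvd f - r \<and> (\<forall>i\<in>S. \<not> m i dvd f \<and> \<not> m i dvd f + c)}"
    for D r
  define \<pi> where "\<pi> = (\<Prod>i\<in>S. 1 - 2 / real CARD('a) ^ degree (m i))"
  let ?q = "real CARD('a)"
  have cop: "coprime D (m i)" using insert.prems by simp
  obtain r1 where r1: "\<And>f. D dvd f - r \<and> m i dvd f - 0 \<longleftrightarrow> D * m i dvd f - r1"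
    using chinese_remainder_coprime[OF cop, of r 0] by blast
  obtain r2 where r2: "\<And>f. D dvd f - r \<and> m i dvd f - (- c) \<longleftrightarrow> D * m i dvd f - r2"
    using chinese_remainder_coprime[OF cop, of r "- c"] by blast
  have nz: "D \<noteq> 0" "m i \<noteq> 0" using insert.prems(1) insert.prems(2)[of i] by auto
  then have degm: "degree (D * m i) = degree D + degree (m i)" by (simp add: degree_mult_eq)
  have monic: "lead_coeff (D * m i) = 1" using insert.prems(1,2) unfolding lead_coeff_mult by simp
  have 0: "real (card (N D r)) = ?q ^ n / ?q ^ degree D * \<pi>"
    unfolding N_def \<pi>_def using insert.prems insert.hyps by (intro insert.IH) auto
  \<comment> \<open>The count does not depend on the residue, so one instance serves both removed
    classes \<open>r1\<close> and \<open>r2\<close>.\<close>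
  have 1: "real (card (N (D * m i) s)) = ?q ^ n / ?q ^ degree (D * m i) * \<pi>" for s
    unfolding N_def \<pi>_def
  proof (rule insert.IH)
    fix j assume "j \<in> S"
    with insert.prems insert.hyps show "coprime (D * m i) (m j)"
      by (intro coprime_mult_leftI) auto
  qed (use insert.prems insert.hyps degm monic in auto)
  have sub: "N (D * m i) r1 \<subseteq> N D r" "N (D * m i) r2 \<subseteq> N D r"
    unfolding N_def using r1 r2 by blast+
  have disj: "N (D * m i) r1 \<inter> N (D * m i) r2 = {}"
  proof -
    have False if "f \<in> N (D * m i) r1" "f \<in> N (D * m i) r2" for f
    proof -
      have "m i dvd f" "m i dvd f + c"
        using that r1[of f] r2[of f] by (auto simp: N_def)
      then show False using insert.prems(5)[of i] dvd_add_right_iff[of "m i" f c] by auto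
    qed
    then show ?thesis by blast
  qed
  have fin: "finite (N D r)" unfolding N_def by simp
  have "{f \<in> monic_polys n. D dvd f - r \<and> (\<forall>i\<in>insert i S. \<not> m i dvd f \<and> \<not> m i dvd f + c)}
      = N D r - (N (D * m i) r1 \<union> N (D * m i) r2)"
    unfolding N_def using r1 r2 by auto
  moreover have "card (N D r - (N (D * m i) r1 \<union> N (D * m i) r2)) =
      card (N D r) - (card (N (D * m i) r1) + card (N (D * m i) r2))"
    using sub fin disj by (simp add: card_Diff_subset card_Un_disjoint finite_subset)
  \<comment> \<open>This rules out truncation when the subtraction of naturals is read in the
    reals.\<close>
  moreover have "card (N (D * m i) r1) + card (N (D * m i) r2) \<le> card (N D r)"
    using sub fin disj by (metis card_Un_disjoint card_mono finite_subset Un_least)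
  ultimately have "real (card {f \<in> monic_polys n. D dvd f - r \<and>
        (\<forall>i\<in>insert i S. \<not> m i dvd f \<and> \<not> m i dvd f + c)})
      = ?q ^ n / ?q ^ degree D * \<pi> - 2 * (?q ^ n / ?q ^ degree (D * m i) * \<pi>)"
    using 0 1 by (simp add: of_nat_diff)
  also have "\<dots> = ?q ^ n / ?q ^ degree D * ((1 - 2 / ?q ^ degree (m i)) * \<pi>)"
    by (simp add: degm power_add field_simps)
  finally show ?case using insert.hyps by (simp add: \<pi>_def)
qed

section \<open>Sums over monic polynomials\<close>

lemma finite_field_card_ge_2: "CARD('a::{finite,field}) \<ge> 2"
  using card_mono[of "UNIV :: 'a set" "{0, 1}"] by simp

text \<open>The induction carries the slack \<open>1 / q ^ N\<close> on the left; the step is then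
  \<open>2 / q ^ Suc N \<le> 1 / q ^ N\<close>, that is, \<open>q \<ge> 2\<close>.\<close>

lemma sum_power_inverse_le:
  fixes q :: real
  assumes "q \<ge> 2"
  shows "(\<Sum>d\<in>{y<..N}. 1 / q ^ d) \<le> 1 / q ^ y"
proof (cases "y \<le> N")
  case True
  then have "(\<Sum>d\<in>{y<..N}. 1 / q ^ d) + 1 / q ^ N \<le> 1 / q ^ y"
  proof (induction N rule: dec_induct)
    case (step N)
    have "1 / q ^ Suc N + 1 / q ^ Suc N \<le> 1 / q ^ N"
      using assms by (simp add: field_simps)
    moreover have "{y<..Suc N} = insert (Suc N) {y<..N}" using step.hyps by auto
    ultimately show ?case using step.IH by simp
  qed simp
  moreover have "1 / q ^ N \<ge> 0" using assms by simp
  ultimately show ?thesis by linarith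
qed (use assms in simp)

lemma finite_monic_degree_le:
  "finite {P :: 'a::{finite,field} poly. lead_coeff P = 1 \<and> degree P \<le> y}"
proof (rule finite_subset)
  show "{P :: 'a poly. lead_coeff P = 1 \<and> degree P \<le> y} \<subseteq> (\<Union>d\<le>y. monic_polys d)"
    by (auto simp: monic_polys_def)
qed simp

text \<open>A crude geometric sum. It bounds the number of irreducibles that are sieved, and with it
  the degree of the product of their \<open>k\<close>-th powers.\<close>

lemma card_monic_degree_le:
  "card {P :: 'a::{finite,field} poly. lead_coeff P = 1 \<and> degree P \<le> y} \<le> CARD('a) ^ Suc y"
proof -
  have "{P :: 'a poly. lead_coeff P = 1 \<and> degree P \<le> y} = (\<Union>d\<in>{..y}. monic_polys d)"
    by (auto simp: monic_polys_def)
  then have "card {P :: 'a poly. lead_coeff P = 1 \<and> degree P \<le> y}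
      \<le> (\<Sum>d\<le>y. card (monic_polys d :: 'a poly set))"
    by (simp add: card_UN_le)
  also have "\<dots> = (\<Sum>d\<le>y. CARD('a) ^ d)" by (simp add: card_monic_polys)
  also have "\<dots> \<le> CARD('a) ^ Suc y"
  proof (induction y)
    case (Suc y)
    have "2 * CARD('a) ^ Suc y \<le> CARD('a) * CARD('a) ^ Suc y"
      by (intro mult_right_mono finite_field_card_ge_2) simp
    with Suc show ?case unfolding sum.atMost_Suc power_Suc[of _ "Suc y"] by linarith
  qed simp
  finally show ?thesis .
qed

text \<open>Irreducibility is dropped: the \<open>q ^ d\<close> monic polynomials of degree
  \<open>d\<close> contribute at most \<open>q ^ d / q ^ (2 * d) = 1 / q ^ d\<close>, and the
  geometric tail remains.\<close>

lemma sum_monic_tail_le: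
  fixes F :: "'a::{finite,field} poly set"
  assumes "finite F" and "k \<ge> 2" and "\<And>P. P \<in> F \<Longrightarrow> lead_coeff P = 1 \<and> degree P > y"
  shows "(\<Sum>P\<in>F. 1 / real CARD('a) ^ (k * degree P)) \<le> 1 / real CARD('a) ^ y"
proof -
  let ?q = "real CARD('a)"
  have q: "?q \<ge> 2" using finite_field_card_ge_2[where 'a = 'a] by linarith
  \<comment> \<open>Inserting 0 keeps the maximum meaningful for empty \<open>F\<close>.\<close>
  define N where "N = Max (insert 0 (degree ` F))"
  have N: "degree P \<le> N" if "P \<in> F" for P
    unfolding N_def using assms(1) that by (intro Max_ge) auto
  have "(\<Sum>P\<in>F. 1 / ?q ^ (k * degree P)) \<le>
      (\<Sum>P\<in>(\<Union>d\<in>{y<..N}. monic_polys d :: 'a poly set). 1 / ?q ^ (k * degree P))"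
    using assms N
    by (intro sum_mono2) (auto simp: monic_polys_def finite_monic_polys [unfolded monic_polys_def])
  also have "\<dots> = (\<Sum>d\<in>{y<..N}. \<Sum>P\<in>(monic_polys d :: 'a poly set). 1 / ?q ^ (k * degree P))"
    by (intro sum.UNION_disjoint)
      (auto simp: monic_polys_def finite_monic_polys [unfolded monic_polys_def])
  also have "\<dots> = (\<Sum>d\<in>{y<..N}. \<Sum>P\<in>(monic_polys d :: 'a poly set). 1 / ?q ^ (k * d))"
    by (intro sum.cong) (auto simp: monic_polys_def)
  also have "\<dots> = (\<Sum>d\<in>{y<..N}. ?q ^ d / ?q ^ (k * d))"
    by (simp add: card_monic_polys)
  also have "\<dots> \<le> (\<Sum>d\<in>{y<..N}. 1 / ?q ^ d)"
  proof (intro sum_mono)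
    fix d
    have "?q ^ d * ?q ^ d = ?q ^ (2 * d)" by (simp add: power_add [symmetric] mult_2)
    also have "\<dots> \<le> ?q ^ (k * d)"
      using assms(2) q by (intro power_increasing mult_right_mono) auto
    finally show "?q ^ d / ?q ^ (k * d) \<le> 1 / ?q ^ d"
      using q by (simp add: field_simps)
  qed
  also have "\<dots> \<le> 1 / ?q ^ y" using q by (rule sum_power_inverse_le)
  finally show ?thesis .
qed

section \<open>Infinite products with factors in the unit interval\<close>

lemma prod_subset_le:
  fixes f :: "'i \<Rightarrow> real"
  assumes "finite T" "S \<subseteq> T" "\<And>i. i \<in> T \<Longrightarrow> f i \<in> {0..1}"
  shows "prod f T \<le> prod f S"
proof -
  have "prod f T = prod f (T - S) * prod f S"
    using assms by (simp add: prod.subset_diff)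
  also have "\<dots> \<le> 1 * prod f S"
    using assms by (intro mult_right_mono prod_le_1 prod_nonneg) auto
  finally show ?thesis by simp
qed

text \<open>Finite partial products decrease as the index set grows and are bounded below by 0, so
  the net converges to its infimum.\<close>

lemma has_infinite_product_Inf:
  assumes "\<And>i. i \<in> A \<Longrightarrow> f i \<in> {0..1::real}"
  shows "has_infinite_product f A (INF S\<in>{S. finite S \<and> S \<subseteq> A}. prod f S)" (is "has_infinite_product f A ?p")
proof -
  let ?F = "{S. finite S \<and> S \<subseteq> A}"
  have bdd: "bdd_below (prod f ` ?F)"
  proof (rule bdd_belowI2)
    fix S assume "S \<in> ?F"
    with assms show "0 \<le> prod f S" by (intro prod_nonneg) auto
  qed
  show ?thesis unfolding has_infinite_product_def
  proof (rule decreasing_tendsto)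
    show "\<forall>\<^sub>F S in finite_subsets_at_top A. ?p \<le> prod f S"
      unfolding eventually_finite_subsets_at_top
      by (intro exI[of _ "{}"]) (auto intro!: cINF_lower bdd)
    fix x assume "?p < x"
    then obtain S where S: "S \<in> ?F" "prod f S < x"
      using bdd by (subst (asm) cINF_less_iff) auto
    have "prod f T < x" if "finite T" "S \<subseteq> T" "T \<subseteq> A" for T
      using prod_subset_le[OF that(1,2), of f] that assms S by fastforce
    with S show "\<forall>\<^sub>F T in finite_subsets_at_top A. prod f T < x"
      unfolding eventually_finite_subsets_at_top by (intro exI[of _ S]) auto
  qed
qed

lemma infinite_product_eqI:
  "has_infinite_product f A p \<Longrightarrow> infinite_product f A = p"
  unfolding has_infinite_product_def infinite_product_def
  by (intro tendsto_Lim) auto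

lemma has_infinite_product_infinite_product:
  assumes "\<And>i. i \<in> A \<Longrightarrow> f i \<in> {0..1::real}"
  shows "has_infinite_product f A (infinite_product f A)"
proof -
  obtain p where "has_infinite_product f A p" using has_infinite_product_Inf[of A f] assms by blast
  then show ?thesis by (simp add: infinite_product_eqI)
qed

lemma infinite_product_le_prod:
  fixes f :: "'i \<Rightarrow> real"
  assumes "\<And>i. i \<in> A \<Longrightarrow> f i \<in> {0..1}" "finite S" "S \<subseteq> A"
  shows "infinite_product f A \<le> prod f S"
proof (rule tendsto_upperbound)
  show "(prod f \<longlongrightarrow> infinite_product f A) (finite_subsets_at_top A)"
    using has_infinite_product_infinite_product[of A f] assms(1)
    unfolding has_infinite_product_def by simp
  show "\<forall>\<^sub>F T in finite_subsets_at_top A. prod f T \<le> prod f S"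
    unfolding eventually_finite_subsets_at_top
    using assms by (intro exI[of _ S]) (auto intro!: prod_subset_le)
qed simp

text \<open>For finite \<open>T\<close> containing \<open>S\<close>, the product over
  \<open>T\<close> is at least \<open>(1 - e) * prod f S\<close>, and this is at least
  \<open>prod f S - e\<close> because \<open>prod f S \<le> 1\<close>. The bound survives the limit
  over \<open>T\<close>.\<close>

lemma prod_minus_le_infinite_product:
  fixes f :: "'i \<Rightarrow> real"
  assumes f: "\<And>i. i \<in> A \<Longrightarrow> f i \<in> {0..1}" and "finite S" "S \<subseteq> A"
    and e: "\<And>F. finite F \<Longrightarrow> F \<subseteq> A - S \<Longrightarrow> 1 - e \<le> prod f F"
  shows "prod f S - e \<le> infinite_product f A"
proof (rule tendsto_lowerbound)
  show "(prod f \<longlongrightarrow> infinite_product f A) (finite_subsets_at_top A)"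
    using has_infinite_product_infinite_product[of A f] assms(1)
    unfolding has_infinite_product_def by simp
  have "prod f S - e \<le> prod f T" if T: "finite T" "S \<subseteq> T" "T \<subseteq> A" for T
  proof -
    \<comment> \<open>The empty product gives \<open>1 - e \<le> 1\<close>.\<close>
    have "0 \<le> e" using e[of "{}"] by simp
    have "0 \<le> prod f S" "prod f S \<le> 1"
      using f assms by (auto intro!: prod_nonneg prod_le_1)
    have "e * prod f S \<le> e * 1" using \<open>prod f S \<le> 1\<close> \<open>0 \<le> e\<close> by (rule mult_left_mono)
    then have "prod f S - e \<le> (1 - e) * prod f S" by (simp add: algebra_simps)
    also have "\<dots> \<le> prod f (T - S) * prod f S"
      using T \<open>0 \<le> prod f S\<close> by (intro mult_right_mono e) auto
    also have "\<dots> = prod f T" using T by (simp add: prod.subset_diff)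
    finally show ?thesis .
  qed
  then show "\<forall>\<^sub>F T in finite_subsets_at_top A. prod f S - e \<le> prod f T"
    unfolding eventually_finite_subsets_at_top
    using assms by (intro exI[of _ S]) auto
qed simp

section \<open>The sieve\<close>

lemma local_factor_unit_interval:
  fixes P :: "'a::{finite,field} poly"
  assumes "P \<in> monic_irreducibles" and "k \<ge> 2"
  shows "2 / real CARD('a) ^ (k * degree P) \<in> {0..1}"
proof -
  have "k * degree P \<ge> 1"
    using degree_monic_irreducible_pos[OF assms(1)] assms(2) by simp
  then have "CARD('a) ^ 1 \<le> CARD('a) ^ (k * degree P)"
    by (intro power_increasing) simp_all
  then have "2 \<le> CARD('a) ^ (k * degree P)"
    using finite_field_card_ge_2[where 'a = 'a] by simp
  then have "2 \<le> real (CARD('a) ^ (k * degree P))" by linarith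
  then show ?thesis by (simp add: field_simps)
qed

text \<open>The upper bound is monotonicity of partial products. For the lower one, Weierstrass'
  inequality bounds any finite product over degrees above \<open>y\<close> below by 1 minus the sum
  of the terms \<open>2 / q ^ (k * degree P)\<close>.\<close>

lemma infinite_product_tail:
  fixes k y :: nat
  defines "g \<equiv> \<lambda>P :: 'a::{finite,field} poly. 1 - 2 / real CARD('a) ^ (k * degree P)"
  assumes "k \<ge> 2"
  shows "infinite_product g monic_irreducibles \<in>
    {prod g {P \<in> monic_irreducibles. degree P \<le> y} - 2 / real CARD('a) ^ y ..
     prod g {P \<in> monic_irreducibles. degree P \<le> y}}"
proof -
  define S where "S = {P :: 'a poly. P \<in> monic_irreducibles \<and> degree P \<le> y}"
  have "finite S" by (rule finite_subset[OF _ finite_monic_degree_le[of y]])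
      (auto simp: S_def monic_irreducibles_def)
  have g: "g P \<in> {0..1}" if "P \<in> monic_irreducibles" for P
    using local_factor_unit_interval[OF that assms(2)] by (auto simp: g_def)
  have "1 - 2 / real CARD('a) ^ y \<le> prod g F"
    if F: "finite F" "F \<subseteq> monic_irreducibles - S" for F
  proof -
    have "(\<Sum>P\<in>F. 2 / real CARD('a) ^ (k * degree P)) = 2 * (\<Sum>P\<in>F. 1 / real CARD('a) ^ (k * degree P))"
      by (simp add: sum_distrib_left)
    also have "\<dots> \<le> 2 * (1 / real CARD('a) ^ y)"
      using F assms(2)
      by (intro mult_left_mono sum_monic_tail_le) (auto simp: S_def monic_irreducibles_def)
    finally have "1 - 2 / real CARD('a) ^ y \<le> 1 - (\<Sum>P\<in>F. 2 / real CARD('a) ^ (k * degree P))"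
      by simp
    also have "\<dots> \<le> prod g F" unfolding g_def
      using F assms(2) by (intro Weierstrass_prod_ineq local_factor_unit_interval) auto
    finally show ?thesis .
  qed
  then show ?thesis
    using infinite_product_le_prod[of monic_irreducibles g S]
      prod_minus_le_infinite_product[of monic_irreducibles g S] g \<open>finite S\<close>
    by (auto simp: S_def)
qed

text \<open>\<open>H\<close> imposes only the conditions at irreducibles in \<open>S\<close> and is
  counted exactly by the sieve. It contains \<open>G\<close>, and \<open>H - G\<close> is covered by
  the sets \<open>W 0 P\<close> and \<open>W [:- a:] P\<close> with \<open>P\<close> in
  \<open>T\<close>.\<close>

lemma card_power_free_pairs:
  fixes a :: "'a::{finite,field}" and k y n :: nat
  defines "S \<equiv> {P :: 'a poly. P \<in> monic_irreducibles \<and> degree P \<le> y}"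
  defines "\<pi> \<equiv> \<Prod>P\<in>S. 1 - 2 / real CARD('a) ^ (k * degree P)"
  assumes "k \<ge> 2" "a \<noteq> 0" "n \<ge> 1" "k * y * CARD('a) ^ Suc y \<le> n"
  shows "real (card {f \<in> monic_polys n. f \<in> monic_kth_power_free k \<and>
      f + [:a:] \<in> monic_kth_power_free k}) / real CARD('a) ^ n \<in> {\<pi> - 2 / real CARD('a) ^ y .. \<pi>}"
proof -
  let ?q = "real CARD('a)"
  have q: "?q > 0" by simp
  define G where "G = {f \<in> monic_polys n. f \<in> monic_kth_power_free k \<and>
      f + [:a:] \<in> monic_kth_power_free k}"
  define H where "H = {f \<in> monic_polys n. \<forall>P\<in>S. \<not> P ^ k dvd f \<and> \<not> P ^ k dvd f + [:a:]}"
  define T where "T = {P :: 'a poly. P \<in> monic_irreducibles \<and> degree P > y \<and> degree P \<le> n}"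
  define W where "W r P = {f \<in> monic_polys n. P ^ k dvd f - r}" for r P :: "'a poly"
  have finS: "finite S" and finT: "finite T"
    by (rule finite_subset[OF _ finite_monic_degree_le[of "max y n"]],
        auto simp: S_def T_def monic_irreducibles_def)+
  have monic_power: "lead_coeff (P ^ k) = 1" and deg_power: "degree (P ^ k) = k * degree P"
    if "P \<in> monic_irreducibles" for P :: "'a poly"
    using that by (auto simp: monic_irreducibles_def lead_coeff_power intro!: degree_power_eq)
  have "card S \<le> CARD('a) ^ Suc y"
    by (rule le_trans[OF card_mono[OF finite_monic_degree_le] card_monic_degree_le])
      (auto simp: S_def monic_irreducibles_def)
  have "(\<Sum>P\<in>S. degree (P ^ k)) = (\<Sum>P\<in>S. k * degree P)"
    by (intro sum.cong) (auto simp: S_def deg_power)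
  also have "\<dots> \<le> of_nat (card S) * (k * y)"
    by (intro sum_bounded_above) (auto simp: S_def)
  also have "\<dots> \<le> CARD('a) ^ Suc y * (k * y)"
    using \<open>card S \<le> _\<close> by (intro mult_right_mono) auto
  finally have degS: "(\<Sum>P\<in>S. degree (P ^ k)) \<le> n"
    using assms(6) by (simp add: mult_ac)
  \<comment> \<open>A nonzero constant has no divisor of positive degree; hence the classes of 0 and
    \<open>-a\<close> modulo \<open>P ^ k\<close> are distinct.\<close>
  have not_dvd: "\<not> P ^ k dvd [:a:]" if "P \<in> monic_irreducibles" for P
    using degree_monic_irreducible_pos[OF that] deg_power[OF that] assms(3,4)
    by (auto dest: dvd_imp_degree_le)
  \<comment> \<open>The sieve starts from the trivial modulus \<open>D = 1\<close>, whose residue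
    condition is void.\<close>
  have "real (card {f \<in> monic_polys n. 1 dvd f - 0 \<and> (\<forall>P\<in>S. \<not> P ^ k dvd f \<and> \<not> P ^ k dvd f + [:a:])})
      = ?q ^ n / ?q ^ degree (1 :: 'a poly) * (\<Prod>P\<in>S. 1 - 2 / ?q ^ degree (P ^ k))"
  proof (rule card_sieve)
    fix P Q assume "P \<in> S" "Q \<in> S" "P \<noteq> Q"
    then have "coprime P Q" by (intro monic_irreducibles_coprime) (auto simp: S_def)
    then show "coprime (P ^ k) (Q ^ k)"
      by (metis coprime_power_leftI coprime_commute)
  qed (use finS degS not_dvd monic_power in \<open>auto simp: S_def\<close>)
  also have "(\<Prod>P\<in>S. 1 - 2 / ?q ^ degree (P ^ k)) = \<pi>"
    unfolding \<pi>_def by (intro prod.cong) (auto simp: S_def deg_power)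
  finally have H: "real (card H) / ?q ^ n = \<pi>" by (simp add: H_def)
  have "G \<subseteq> H"
    by (auto simp: G_def H_def S_def monic_kth_power_free_def kth_power_free_def)
  have finH: "finite H" by (simp add: H_def)
  have minus_const: "f - [:- a:] = f + [:a:]" for f by (subst diff_conv_add_uminus) simp
  have shift: "f + [:a:] \<in> monic_polys n" if "f \<in> monic_polys n" for f
  proof -
    have "f - [:- a:] \<in> monic_polys n"
      using that assms(5) by (intro monic_polys_diff) simp_all
    then show ?thesis by (simp only: minus_const)
  qed
  have W: "real (card (W r P)) \<le> ?q ^ n * (1 / ?q ^ (k * degree P))"
    if "P \<in> monic_irreducibles" "degree r = 0" for r P
    using card_monic_polys_residue_le[of "P ^ k" r n] monic_power[OF that(1)] deg_power[OF that(1)]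
      that(2) assms(5) by (simp add: W_def)
  \<comment> \<open>Only irreducibles of degree at most \<open>n\<close> can be obstructions, so the
    finite set \<open>T\<close> suffices for the union bound.\<close>
  have small: "degree P \<le> n"
    if "P \<in> monic_irreducibles" "h \<in> monic_polys n" "P ^ k dvd h" for P h :: "'a poly"
  proof -
    have "h \<noteq> 0" using that(2) by (auto simp: monic_polys_def)
    then have "k * degree P \<le> n"
      using dvd_imp_degree_le[OF that(3)] that(2) deg_power[OF that(1)] by (simp add: monic_polys_def)
    moreover have "1 * degree P \<le> k * degree P" using assms(3) by (intro mult_right_mono) auto
    ultimately show ?thesis by linarith
  qed
  have "H \<subseteq> G \<union> (\<Union>P\<in>T. W 0 P \<union> W [:- a:] P)"
  proof
    fix f assume f: "f \<in> H"
    show "f \<in> G \<union> (\<Union>P\<in>T. W 0 P \<union> W [:- a:] P)"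
    proof (cases "f \<in> G")
      case False
      have fn: "f \<in> monic_polys n" using f by (simp add: H_def)
      have "lead_coeff f = 1" "lead_coeff (f + [:a:]) = 1"
        using fn shift[OF fn] unfolding monic_polys_def by blast+
      with False fn obtain P where P: "P \<in> monic_irreducibles" "P ^ k dvd f \<or> P ^ k dvd f + [:a:]"
        by (auto simp: G_def monic_kth_power_free_def kth_power_free_def)
      have "P \<notin> S" using f P by (auto simp: H_def)
      moreover have "degree P \<le> n" using small P fn shift by blast
      ultimately have "P \<in> T" using P by (auto simp: T_def S_def)
      then show ?thesis using P(2) fn unfolding W_def minus_const by auto
    qed simp
  qed
  moreover have "finite (G \<union> (\<Union>P\<in>T. W 0 P \<union> W [:- a:] P))"
    using finT by (auto simp: G_def W_def)
  ultimately have "card H \<le> card (G \<union> (\<Union>P\<in>T. W 0 P \<union> W [:- a:] P))"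
    by (rule card_mono[rotated])
  also have "\<dots> \<le> card G + card (\<Union>P\<in>T. W 0 P \<union> W [:- a:] P)" by (rule card_Un_le)
  also have "card (\<Union>P\<in>T. W 0 P \<union> W [:- a:] P) \<le> (\<Sum>P\<in>T. card (W 0 P \<union> W [:- a:] P))"
    using finT by (rule card_UN_le)
  also have "\<dots> \<le> (\<Sum>P\<in>T. card (W 0 P) + card (W [:- a:] P))"
    by (intro sum_mono card_Un_le)
  finally have "real (card H) \<le> real (card G + (\<Sum>P\<in>T. card (W 0 P) + card (W [:- a:] P)))"
    by (simp only: of_nat_le_iff add_left_mono)
  also have "\<dots> = real (card G) + (\<Sum>P\<in>T. real (card (W 0 P)) + real (card (W [:- a:] P)))"
    by simp
  also have "\<dots> \<le> real (card G) +
      (\<Sum>P\<in>T. ?q ^ n * (1 / ?q ^ (k * degree P)) + ?q ^ n * (1 / ?q ^ (k * degree P)))"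
    by (intro add_left_mono sum_mono add_mono W) (auto simp: T_def)
  also have "\<dots> = real (card G) + 2 * ?q ^ n * (\<Sum>P\<in>T. 1 / ?q ^ (k * degree P))"
    by (simp add: sum_distrib_left)
  also have "\<dots> \<le> real (card G) + 2 * ?q ^ n * (1 / ?q ^ y)"
    using finT assms(3)
    by (intro add_left_mono mult_left_mono sum_monic_tail_le) (auto simp: T_def monic_irreducibles_def)
  finally have "real (card H) / ?q ^ n \<le> real (card G) / ?q ^ n + 2 / ?q ^ y"
    using q by (simp add: field_simps)
  moreover have "real (card G) / ?q ^ n \<le> real (card H) / ?q ^ n"
    using card_mono[OF finH \<open>G \<subseteq> H\<close>] by (intro divide_right_mono) auto
  ultimately have "real (card G) / ?q ^ n \<in> {\<pi> - 2 / ?q ^ y .. \<pi>}" using H by auto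
  then show ?thesis by (simp add: G_def)
qed

section \<open>Choice of the cutoff and the error term\<close>

theorem corollary1p4:
  fixes a :: "'a::{finite,field}" and q k :: nat and B :: real
  assumes "q = CARD('a)" and "odd q" and "k \<ge> 2" and "a \<noteq> 0" and "0 < B" and "B < 1"
  shows "(\<exists>p. has_infinite_product (\<lambda>P :: 'a poly. 1 - 2 / real q ^ (k * degree P)) monic_irreducibles p) \<and>
    (\<lambda>n. 1 / real q ^ n *
           (\<Sum>f | f \<in> monic_polys n \<and> f \<in> monic_kth_power_free k \<and>
                   f + [:a:] \<in> monic_kth_power_free k. 1)
         - infinite_product (\<lambda>P :: 'a poly. 1 - 2 / real q ^ (k * degree P)) monic_irreducibles)
      \<in> O(\<lambda>n. 1 / real n powr B)"
proof
  let ?g = "\<lambda>P :: 'a poly. 1 - 2 / real q ^ (k * degree P)"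
  have "?g P \<in> {0..1}" if "P \<in> monic_irreducibles" for P
    using local_factor_unit_interval[OF that assms(3)] assms(1) by auto
  then show "\<exists>p. has_infinite_product ?g monic_irreducibles p"
    by (intro exI[of _ "infinite_product ?g monic_irreducibles"] has_infinite_product_infinite_product)
  have q2: "real q \<ge> 2" using finite_field_card_ge_2[where 'a = 'a] assms(1) by linarith
  \<comment> \<open>Since \<open>B < 1\<close>, the left side is of order
    \<open>n powr B * ln n\<close> and falls below \<open>n\<close>; it will dominate
    \<open>k * y * q ^ Suc y\<close>.\<close>
  have "\<forall>\<^sub>F n in sequentially. real k * (B * log (real q) (real n)) * (real q * real n powr B) \<le> real n"
    using q2 assms(5,6) unfolding log_def by real_asymp
  then have "\<forall>\<^sub>F n in sequentially.
    norm (1 / real q ^ n * (\<Sum>f | f \<in> monic_polys n \<and> f \<in> monic_kth_power_free k \<and>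
                   f + [:a:] \<in> monic_kth_power_free k. 1) - infinite_product ?g monic_irreducibles)
    \<le> 2 * real q * norm (1 / real n powr B)"
    using eventually_ge_at_top[of 1]
  proof eventually_elim
    case (elim n)
    \<comment> \<open>This is the largest \<open>y\<close> with \<open>q ^ y \<le> n powr B\<close>:
      the lower bound keeps the modulus small, while \<open>n powr B \<le> q ^ Suc y\<close>
      controls the error.\<close>
    define y where "y = nat \<lfloor>B * log (real q) (real n)\<rfloor>"
    have "log (real q) (real n) \<ge> 0" using q2 elim by simp
    then have y: "real y \<le> B * log (real q) (real n)" "B * log (real q) (real n) \<le> real (Suc y)"
      using assms(5) unfolding y_def by (simp, linarith)
    have nB: "real n powr B = real q powr (B * log (real q) (real n))"
      using q2 elim by (simp add: powr_powr [symmetric] mult.commute[of B])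
    have "real q ^ y \<le> real n powr B"
      unfolding nB using y q2 by (simp add: powr_realpow [symmetric])
    have "real n powr B \<le> real q ^ Suc y"
      unfolding nB using y(2) q2 by (subst powr_realpow [symmetric]) auto
    have "real k * real y * (real q * real q ^ y)
        \<le> real k * (B * log (real q) (real n)) * (real q * real n powr B)"
      using y \<open>real q ^ y \<le> real n powr B\<close> \<open>log (real q) (real n) \<ge> 0\<close> assms(5)
      by (intro mult_mono) auto
    with elim have "real (k * y * q ^ Suc y) \<le> real n" by simp
    then have le: "k * y * CARD('a) ^ Suc y \<le> n" using assms(1) by (simp only: of_nat_le_iff)
    \<comment> \<open>The density and the infinite product lie in the same interval of length
      \<open>2 / q ^ y\<close> ending at the partial product.\<close>
    have "\<bar>real (card {f \<in> monic_polys n. f \<in> monic_kth_power_free k \<and>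
                   f + [:a:] \<in> monic_kth_power_free k}) / real q ^ n
        - infinite_product ?g monic_irreducibles\<bar> \<le> 2 / real q ^ y"
      using card_power_free_pairs[OF assms(3,4) _ le] infinite_product_tail[OF assms(3), where y = y and 'a = 'a]
        elim assms(1) by (auto simp: abs_le_iff)
    \<comment> \<open>Rounding \<open>y\<close> down costs at most one factor \<open>q\<close>,
      which explains the constant \<open>2 * q\<close>.\<close>
    also have "\<dots> \<le> 2 * real q * (1 / real n powr B)"
      using \<open>real n powr B \<le> real q ^ Suc y\<close> q2 elim by (simp add: field_simps)
    finally show ?case by simp
  qed
  then show "(\<lambda>n. 1 / real q ^ n * (\<Sum>f | f \<in> monic_polys n \<and> f \<in> monic_kth_power_free k \<and>
                   f + [:a:] \<in> monic_kth_power_free k. 1) - infinite_product ?g monic_irreducibles)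
    \<in> O(\<lambda>n. 1 / real n powr B)"
    by (rule bigoI)
qed

end
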